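(* Let $G=(V,E)$ be a finite simple graph with $E\neq\emptyset$ and let $p$ be a positive integer. If $\gamma_p(G)>p$, then $r_p(G)=\eta_p(G)$.
   Context: For $x\in V$, $N_G(x)$ is the set of neighbours of $x$. A set $D\subseteq V$ is a $p$-dominating set if every vertex $x\notin D$ satisfies $|N_G(x)\cap D|\ge p$; $\gamma_p(G)$ is the minimum size of a $p$-dominating set. $G^c$ denotes the complement of $G$, and for $B\subseteq E(G^c)$, $G+B$ is the graph $(V,E\cup B)$. The $p$-reinforcement number is $r_p(G)=\min\{|B| : B\subseteq E(G^c),\ \gamma_p(G+B)<\gamma_p(G)\}$, with the convention $r_p(G)=0$ if $\gamma_p(G)\le p$. For $X\subseteq V$ and $x\in V$, define $\eta_p(x,X,G)=p-|N_G(x)\cap X|$ if $x\notin X$ and $|N_G(x)\cap X|<p$, and $\eta_p(x,X,G)=0$ otherwise. Define $\eta_p(G)=\min\{\sum_{x\in V}\eta_p(x,X,G) : X\subseteq V,\ |X|<\gamma_p(G)\}$. *)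

theory Defs
  imports "HOL-Library.Ramsey"
begin

text \<open>
  A graph is given by its vertex set \<open>V\<close> and its set \<open>E\<close> of edges, an edge being the two-element
  set of its end vertices; \<open>[V]\<^bsup>2\<^esup>\<close> is the set of all two-element subsets of \<open>V\<close>.
\<close>

definition fin_simple_graph :: "'a set \<Rightarrow> 'a set set \<Rightarrow> bool" where
  "fin_simple_graph V E \<longleftrightarrow> finite V \<and> E \<subseteq> [V]\<^bsup>2\<^esup>"

definition nbhd :: "'a set \<Rightarrow> 'a set set \<Rightarrow> 'a \<Rightarrow> 'a set" where
  "nbhd V E x = {y \<in> V. {x, y} \<in> E}"

definition compl_edges :: "'a set \<Rightarrow> 'a set set \<Rightarrow> 'a set set" where
  "compl_edges V E = [V]\<^bsup>2\<^esup> - E"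

definition p_dominating :: "nat \<Rightarrow> 'a set \<Rightarrow> 'a set set \<Rightarrow> 'a set \<Rightarrow> bool" where
  "p_dominating p V E D \<longleftrightarrow> D \<subseteq> V \<and> (\<forall>x \<in> V - D. card (nbhd V E x \<inter> D) \<ge> p)"

definition p_domination_number :: "nat \<Rightarrow> 'a set \<Rightarrow> 'a set set \<Rightarrow> nat" where
  "p_domination_number p V E = Min {card D | D. p_dominating p V E D}"

text \<open>
  The set under \<open>Min\<close> below is nonempty whenever the \<open>p\<close>-domination number exceeds \<open>p\<close>: adding all
  missing edges yields a complete graph on more than \<open>p\<close> vertices.
\<close>

definition p_reinforcement_number :: "nat \<Rightarrow> 'a set \<Rightarrow> 'a set set \<Rightarrow> nat" where
  "p_reinforcement_number p V E =
     (if p_domination_number p V E \<le> p then 0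
      else Min {card B | B. B \<subseteq> compl_edges V E \<and>
                  p_domination_number p V (E \<union> B) < p_domination_number p V E})"

definition eta_vertex :: "nat \<Rightarrow> 'a \<Rightarrow> 'a set \<Rightarrow> 'a set \<Rightarrow> 'a set set \<Rightarrow> nat" where
  "eta_vertex p x X V E =
     (if x \<notin> X \<and> card (nbhd V E x \<inter> X) < p then p - card (nbhd V E x \<inter> X) else 0)"

definition eta :: "nat \<Rightarrow> 'a set \<Rightarrow> 'a set set \<Rightarrow> nat" where
  "eta p V E =
     Min {(\<Sum>x\<in>V. eta_vertex p x X V E) | X. X \<subseteq> V \<and> card X < p_domination_number p V E}"

end

theory Submission
  imports Defs
begin

text \<open>
  The deficiency of \<open>X\<close>, the sum of the \<open>\<eta>\<^sub>p(x, X, G)\<close>, is the least number of edges whose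
  addition makes \<open>X\<close> a \<open>p\<close>-dominating set, provided \<open>|X| \<ge> p\<close>. An added edge lowers the deficiency
  by at most one; and as long as it is positive, some vertex outside \<open>X\<close> has fewer than \<open>p\<close>
  neighbours in \<open>X\<close>, hence a non-neighbour there, and joining the two lowers it. A smaller \<open>X\<close> may
  be enlarged to \<open>p\<close> vertices: this does not increase the deficiency, and the set stays below
  \<open>\<gamma>\<^sub>p(G)\<close> because \<open>\<gamma>\<^sub>p(G) > p\<close>.
\<close>

lemma finite_nbhd: "finite V \<Longrightarrow> finite (nbhd V E x)"
  by (simp add: nbhd_def)

lemma nbhd_mono: "E \<subseteq> F \<Longrightarrow> nbhd V E x \<subseteq> nbhd V F x"
  by (auto simp: nbhd_def)

lemma nbhd_Un: "nbhd V (E \<union> B) x = nbhd V E x \<union> nbhd V B x"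
  by (auto simp: nbhd_def)

lemma finite_compl_edges: "finite V \<Longrightarrow> finite (compl_edges V E)"
  by (simp add: compl_edges_def finite_imp_finite_nsets)

lemma p_dominating_vertex_set: "p_dominating p V E V"
  by (simp add: p_dominating_def)

lemma p_domination_number_less_iff:
  assumes "finite V"
  shows "p_domination_number p V E < k \<longleftrightarrow> (\<exists>D. p_dominating p V E D \<and> card D < k)"
proof -
  let ?cards = "{card D | D. p_dominating p V E D}"
  have "?cards \<subseteq> card ` Pow V"
    by (auto simp: p_dominating_def)
  then have "finite ?cards"
    by (rule finite_subset) (simp add: assms)
  moreover have "?cards \<noteq> {}"
    using p_dominating_vertex_set by blast
  ultimately show ?thesis
    unfolding p_domination_number_def by (subst Min_less_iff) auto
qed

lemma p_domination_number_le_card: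
  assumes "finite V"
  shows "p_domination_number p V E \<le> card V"
  using p_domination_number_less_iff[OF assms] p_dominating_vertex_set less_Suc_eq_le by blast

definition deficiency :: "nat \<Rightarrow> 'a set \<Rightarrow> 'a set \<Rightarrow> 'a set set \<Rightarrow> nat" where
  "deficiency p X V E = (\<Sum>x\<in>V. eta_vertex p x X V E)"

lemma eta_vertex_eq:
  "eta_vertex p x X V E = (if x \<in> X then 0 else p - card (nbhd V E x \<inter> X))"
  by (simp add: eta_vertex_def)

lemma eta_vertex_antimono:
  assumes "finite V" "X \<subseteq> Y" "E \<subseteq> F"
  shows "eta_vertex p x Y V F \<le> eta_vertex p x X V E"
proof -
  have "card (nbhd V E x \<inter> X) \<le> card (nbhd V F x \<inter> Y)"
    using assms by (intro card_mono finite_Int disjI1 finite_nbhd Int_mono nbhd_mono)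
  then show ?thesis
    using assms(2) by (auto simp: eta_vertex_eq)
qed

lemma deficiency_antimono:
  assumes "finite V" "X \<subseteq> Y" "E \<subseteq> F"
  shows "deficiency p Y V F \<le> deficiency p X V E"
  unfolding deficiency_def using assms by (intro sum_mono eta_vertex_antimono)

lemma p_dominating_iff_deficiency_eq_0:
  assumes "finite V"
  shows "p_dominating p V E X \<longleftrightarrow> X \<subseteq> V \<and> deficiency p X V E = 0"
  using assms by (auto simp: p_dominating_def deficiency_def eta_vertex_eq)

lemma sum_card_nbhd_across_cut_le:
  assumes "finite V" "finite B"
  shows "(\<Sum>x\<in>V - X. card (nbhd V B x \<inter> X)) \<le> card B"
proof -
  let ?cut = "SIGMA x:V - X. nbhd V B x \<inter> X"
  have "(\<Sum>x\<in>V - X. card (nbhd V B x \<inter> X)) = card ?cut"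
    using assms(1) by (simp add: finite_nbhd)
  also have "\<dots> \<le> card B"
  proof (rule card_inj_on_le)
    show "inj_on (\<lambda>(x, y). {x, y}) ?cut"
      by (auto simp: inj_on_def doubleton_eq_iff)
    show "(\<lambda>(x, y). {x, y}) ` ?cut \<subseteq> B"
      by (auto simp: nbhd_def)
  qed (rule assms(2))
  finally show ?thesis .
qed

lemma deficiency_le_add_edges:
  assumes "finite V" "finite B"
  shows "deficiency p X V E \<le> deficiency p X V (E \<union> B) + card B"
proof -
  have vertex: "eta_vertex p x X V E \<le>
      eta_vertex p x X V (E \<union> B) + (if x \<in> X then 0 else card (nbhd V B x \<inter> X))" for x
  proof -
    have "card (nbhd V (E \<union> B) x \<inter> X) \<le> card (nbhd V E x \<inter> X) + card (nbhd V B x \<inter> X)"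
      by (simp add: nbhd_Un Int_Un_distrib2 card_Un_le)
    then show ?thesis
      by (auto simp: eta_vertex_eq)
  qed
  have "deficiency p X V E \<le>
      deficiency p X V (E \<union> B) + (\<Sum>x\<in>V. if x \<in> X then 0 else card (nbhd V B x \<inter> X))"
    unfolding deficiency_def sum.distrib[symmetric] by (intro sum_mono vertex)
  also have "(\<Sum>x\<in>V. if x \<in> X then 0 else card (nbhd V B x \<inter> X)) =
      (\<Sum>x\<in>V - X. card (nbhd V B x \<inter> X))"
    using assms(1) by (intro sum.mono_neutral_cong_right) auto
  also have "\<dots> \<le> card B"
    by (rule sum_card_nbhd_across_cut_le[OF assms])
  finally show ?thesis
    by simp
qed

lemma obtain_edge_reducing_deficiency:
  assumes "finite V" "X \<subseteq> V" "p \<le> card X" "deficiency p X V E \<noteq> 0"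
  obtains e where "e \<in> compl_edges V E" "deficiency p X V (insert e E) < deficiency p X V E"
proof -
  obtain x where x: "x \<in> V" "x \<notin> X" "card (nbhd V E x \<inter> X) < p"
    using assms(1,4) by (auto simp: deficiency_def eta_vertex_eq split: if_splits)
  have "\<not> X \<subseteq> nbhd V E x"
    using x(3) assms(3) by (auto simp: Int_absorb1)
  then obtain y where y: "y \<in> X" "y \<notin> nbhd V E x"
    by blast
  let ?e = "{x, y}"
  have "?e \<in> compl_edges V E"
    using x y assms(2) by (auto simp: compl_edges_def nbhd_def nsets_def card_2_iff)
  moreover have "eta_vertex p x X V (insert ?e E) < eta_vertex p x X V E"
  proof -
    have "nbhd V E x \<inter> X \<subset> nbhd V (insert ?e E) x \<inter> X"
      using y assms(2) by (auto simp: nbhd_def)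
    then have "card (nbhd V E x \<inter> X) < card (nbhd V (insert ?e E) x \<inter> X)"
      using assms(1) by (intro psubset_card_mono) (simp_all add: finite_nbhd)
    then show ?thesis
      using x by (simp add: eta_vertex_eq)
  qed
  then have "deficiency p X V (insert ?e E) < deficiency p X V E"
    unfolding deficiency_def using assms(1) x(1)
    by (intro sum_strict_mono_ex1) (auto intro: eta_vertex_antimono)
  ultimately show thesis
    by (rule that)
qed

lemma ex_p_dominating_add_edges:
  assumes "finite V" "X \<subseteq> V" "p \<le> card X"
  shows "\<exists>B \<subseteq> compl_edges V E. p_dominating p V (E \<union> B) X \<and> card B \<le> deficiency p X V E"
proof (induction "deficiency p X V E" arbitrary: E rule: less_induct)
  case less
  show ?case
  proof (cases "deficiency p X V E = 0")
    case True
    then have "p_dominating p V (E \<union> {}) X"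
      using assms by (simp add: p_dominating_iff_deficiency_eq_0)
    then show ?thesis
      by (intro exI[of _ "{}"]) simp
  next
    case False
    then obtain e where e: "e \<in> compl_edges V E"
        "deficiency p X V (insert e E) < deficiency p X V E"
      using obtain_edge_reducing_deficiency assms by metis
    from less[OF e(2)] obtain B where B: "B \<subseteq> compl_edges V (insert e E)"
        "p_dominating p V (insert e E \<union> B) X" "card B \<le> deficiency p X V (insert e E)"
      by blast
    have "insert e B \<subseteq> compl_edges V E"
      using e(1) B(1) by (auto simp: compl_edges_def)
    moreover have "p_dominating p V (E \<union> insert e B) X"
      using B(2) by simp
    moreover have "card (insert e B) \<le> deficiency p X V E"
      using card_insert_le_m1[of "deficiency p X V E" B e] B(3) e(2) by linarith
    ultimately show ?thesis
      by blast
  qed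
qed

lemma ex_p_domination_number_add_edges_less_iff:
  assumes "finite V" "p \<le> card V" "p < k"
  shows "(\<exists>B \<subseteq> compl_edges V E. p_domination_number p V (E \<union> B) < k \<and> card B \<le> n) \<longleftrightarrow>
    (\<exists>X \<subseteq> V. card X < k \<and> deficiency p X V E \<le> n)"
proof
  assume "\<exists>B \<subseteq> compl_edges V E. p_domination_number p V (E \<union> B) < k \<and> card B \<le> n"
  then obtain B D where B: "B \<subseteq> compl_edges V E" "card B \<le> n"
    and D: "p_dominating p V (E \<union> B) D" "card D < k"
    by (auto simp: p_domination_number_less_iff[OF assms(1)])
  have "finite B"
    using B(1) finite_compl_edges[OF assms(1)] by (rule finite_subset)
  then have "deficiency p D V E \<le> deficiency p D V (E \<union> B) + card B"
    by (rule deficiency_le_add_edges[OF assms(1)])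
  moreover have "D \<subseteq> V" "deficiency p D V (E \<union> B) = 0"
    using D(1) by (simp_all add: p_dominating_iff_deficiency_eq_0[OF assms(1)])
  ultimately show "\<exists>X \<subseteq> V. card X < k \<and> deficiency p X V E \<le> n"
    using B(2) D(2) by (intro exI[of _ D]) simp
next
  assume "\<exists>X \<subseteq> V. card X < k \<and> deficiency p X V E \<le> n"
  then obtain X where X: "X \<subseteq> V" "card X < k" "deficiency p X V E \<le> n"
    by blast
  obtain Y where Y: "X \<subseteq> Y" "Y \<subseteq> V" "card Y = max p (card X)"
    using exists_subset_between[of X "max p (card X)" V] card_mono[OF assms(1) X(1)] X(1) assms(1,2)
    by auto
  obtain B where B: "B \<subseteq> compl_edges V E" "p_dominating p V (E \<union> B) Y"
      "card B \<le> deficiency p Y V E"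
    using ex_p_dominating_add_edges[OF assms(1) Y(2), of p E] Y(3) by auto
  have "p_domination_number p V (E \<union> B) < k"
    using p_domination_number_less_iff[OF assms(1)] B(2) X(2) Y(3) assms(3) by auto
  moreover have "card B \<le> n"
    using B(3) deficiency_antimono[OF assms(1) Y(1) order_refl, of p E] X(3) by linarith
  ultimately show "\<exists>B \<subseteq> compl_edges V E. p_domination_number p V (E \<union> B) < k \<and> card B \<le> n"
    using B(1) by blast
qed

lemma p_reinforcement_number_le_iff:
  assumes "finite V" "p < p_domination_number p V E"
  shows "p_reinforcement_number p V E \<le> n \<longleftrightarrow>
    (\<exists>B \<subseteq> compl_edges V E.
      p_domination_number p V (E \<union> B) < p_domination_number p V E \<and> card B \<le> n)"
proof -
  let ?cards = "{card B | B. B \<subseteq> compl_edges V E \<and>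
    p_domination_number p V (E \<union> B) < p_domination_number p V E}"
  have "?cards \<subseteq> card ` Pow (compl_edges V E)"
    by auto
  then have "finite ?cards"
    by (rule finite_subset) (simp add: finite_compl_edges assms(1))
  moreover have "?cards \<noteq> {}"
  proof -
    have "p \<le> card V"
      using assms(2) p_domination_number_le_card[OF assms(1), of p E] by linarith
    moreover have "\<exists>X \<subseteq> V. card X < p_domination_number p V E \<and>
        deficiency p X V E \<le> deficiency p {} V E"
      using assms(2) by (intro exI[of _ "{}"]) simp
    ultimately obtain B where "B \<subseteq> compl_edges V E"
        "p_domination_number p V (E \<union> B) < p_domination_number p V E"
      using ex_p_domination_number_add_edges_less_iff[OF assms(1) _ assms(2)] by metis
    then show ?thesis
      by blast
  qed
  ultimately have "Min ?cards \<le> n \<longleftrightarrow> (\<exists>m\<in>?cards. m \<le> n)"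
    by (rule Min_le_iff)
  then show ?thesis
    using assms(2) by (auto simp: p_reinforcement_number_def)
qed

lemma eta_le_iff:
  assumes "finite V" "0 < p_domination_number p V E"
  shows "eta p V E \<le> n \<longleftrightarrow>
    (\<exists>X \<subseteq> V. card X < p_domination_number p V E \<and> deficiency p X V E \<le> n)"
proof -
  let ?deficiencies = "{deficiency p X V E | X. X \<subseteq> V \<and> card X < p_domination_number p V E}"
  have "?deficiencies \<subseteq> (\<lambda>X. deficiency p X V E) ` Pow V"
    by auto
  then have "finite ?deficiencies"
    by (rule finite_subset) (simp add: assms(1))
  moreover have "?deficiencies \<noteq> {}"
    using assms(2) by (auto intro: exI[of _ "{}"])
  ultimately have "Min ?deficiencies \<le> n \<longleftrightarrow> (\<exists>m\<in>?deficiencies. m \<le> n)"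
    by (rule Min_le_iff)
  then show ?thesis
    by (auto simp: eta_def deficiency_def)
qed

theorem theorem2p2:
  fixes V :: "'a set" and E :: "'a set set" and p :: nat
  assumes "fin_simple_graph V E"
    and "E \<noteq> {}"
    and "p > 0"
    and "p_domination_number p V E > p"
  shows "p_reinforcement_number p V E = eta p V E"
proof -
  have "finite V"
    using assms(1) by (simp add: fin_simple_graph_def)
  moreover have "p \<le> card V"
    using assms(4) p_domination_number_le_card[OF \<open>finite V\<close>, of p E] by linarith
  ultimately have "p_reinforcement_number p V E \<le> n \<longleftrightarrow> eta p V E \<le> n" for n
    using assms(4)
    by (simp add: p_reinforcement_number_le_iff eta_le_iff
        ex_p_domination_number_add_edges_less_iff)
  then show ?thesis
    by (metis order_refl order_antisym)
qed

end
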